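(* Let $A\in\mathbb{R}^{n\times n}$, $B\in\mathbb{R}^{n\times m}$, $Q=Q^{T}\in\mathbb{R}^{n\times n}$, $S\in\mathbb{R}^{n\times m}$, $R=R^{T}\in\mathbb{R}^{m\times m}$ with $\Pi=\begin{bmatrix}Q&S\\ S^{T}&R\end{bmatrix}\ge 0$. For $x_0\in\mathbb{R}^n$ and an input sequence $u=(u_t)_{t\ge 0}$ in $\mathbb{R}^m$, let $x_{t+1}=Ax_t+Bu_t$ and $$J(x_0,u)=\sum_{t=0}^{\infty}\begin{bmatrix}x_t^{T}&u_t^{T}\end{bmatrix}\Pi\begin{bmatrix}x_t\\ u_t\end{bmatrix}\in[0,+\infty].$$ Suppose that for every $x_0\in\mathbb{R}^n$ there exists an input sequence $u$ such that $J(x_0,u)$ is finite. Then: 1. CGDARE($\Sigma$) admits symmetric solutions: the sequence defined by $X_0=0$, $X_{t+1}=\mathbf{R}[X_t]$ converges as $t\to\infty$ to a matrix $\bar X=\bar X^{T}\ge 0$ which is a solution of CGDARE($\Sigma$). 2. For every $x_0$, the value of the optimal cost (the minimum of $J(x_0,u)$ over all input sequences $u$) is $x_0^{T}\bar X x_0$. 3. $\bar X$ is the minimum positive semidefinite solution of CGDARE($\Sigma$), i.e. $\bar X\le \tilde X$ for every positive semidefinite solution $\tilde X$ of CGDARE($\Sigma$). 4. The set of all optimal controls minimising $J(x_0,u)$ is parameterised as $u_t=-K_{\bar X}x_t+G_{\bar X}v_t$ with $v_t\in\mathbb{R}^m$ arbitrary; that is, an input sequence $u$ with corresponding state trajectory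 $x$ from $x_0$ is optimal if and only if there is a sequence $(v_t)_{t\ge0}$ in $\mathbb{R}^m$ with $u_t=-K_{\bar X}x_t+G_{\bar X}v_t$ for all $t\ge0$.
   Context: $M^{\dagger}$ denotes the Moore-Penrose pseudo-inverse of $M$. The Riccati operator is $\mathbf{R}[P]=A^{T}PA-(A^{T}PB+S)(R+B^{T}PB)^{\dagger}(B^{T}PA+S^{T})+Q$. The iteration $X_{t+1}=\mathbf{R}[X_t]$ is the generalised Riccati difference equation. With $\Sigma=(A,B;Q,R,S)$, a matrix $X=X^{T}\in\mathbb{R}^{n\times n}$ is a solution of CGDARE($\Sigma$) (constrained generalised discrete algebraic Riccati equation) if $X=\mathbf{R}[X]$ and $\ker(R+B^{T}XB)\subseteq\ker(A^{T}XB+S)$. For $X=X^{T}$ set $R_X=R+B^{T}XB$, $S_X=A^{T}XB+S$, $K_X=R_X^{\dagger}S_X^{T}$ and $G_X=I_m-R_X^{\dagger}R_X$. The order $\le$ on symmetric matrices is the Loewner order, and positive semidefinite matrices are symmetric by convention. *)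

theory Defs
  imports "HOL-Analysis.Analysis"
begin

definition symmetric :: "real^'n^'n \<Rightarrow> bool" where
  "symmetric M \<longleftrightarrow> transpose M = M"

definition pos_semidef :: "real^'n^'n \<Rightarrow> bool" where
  "pos_semidef M \<longleftrightarrow> symmetric M \<and> (\<forall>x. 0 \<le> x \<bullet> (M *v x))"

text \<open>The Loewner order; it must not be confused with the componentwise order that the
  library puts on vectors and hence on matrices.\<close>

definition loewner_le :: "real^'n^'n \<Rightarrow> real^'n^'n \<Rightarrow> bool"  (infix "\<preceq>" 50) where
  "X \<preceq> Y \<longleftrightarrow> pos_semidef (Y - X)"

definition ker :: "real^'n^'m \<Rightarrow> (real^'n) set" where
  "ker M = {v. M *v v = 0}"

text \<open>The four Penrose equations determine the Moore-Penrose pseudo-inverse; every real matrix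
  has exactly one.\<close>

definition is_pinv :: "real^'n^'m \<Rightarrow> real^'m^'n \<Rightarrow> bool" where
  "is_pinv M N \<longleftrightarrow>
     M ** N ** M = M \<and> N ** M ** N = N \<and> symmetric (M ** N) \<and> symmetric (N ** M)"

definition pinv :: "real^'n^'m \<Rightarrow> real^'m^'n" where
  "pinv M = (THE N. is_pinv M N)"

text \<open>Block matrices and stacked vectors are indexed by the disjoint sum of the index types.\<close>

definition block_matrix ::
  "real^'n^'p \<Rightarrow> real^'m^'p \<Rightarrow> real^'n^'q \<Rightarrow> real^'m^'q \<Rightarrow> real^('n + 'm)^('p + 'q)" where
  "block_matrix M11 M12 M21 M22 =
     (\<chi> i j. case i of
         Inl a \<Rightarrow> (case j of Inl b \<Rightarrow> M11 $ a $ b | Inr b \<Rightarrow> M12 $ a $ b)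
       | Inr a \<Rightarrow> (case j of Inl b \<Rightarrow> M21 $ a $ b | Inr b \<Rightarrow> M22 $ a $ b))"

definition stack :: "real^'n \<Rightarrow> real^'m \<Rightarrow> real^('n + 'm)" where
  "stack x u = (\<chi> i. case i of Inl a \<Rightarrow> x $ a | Inr b \<Rightarrow> u $ b)"

definition Popov :: "real^'n^'n \<Rightarrow> real^'m^'m \<Rightarrow> real^'m^'n \<Rightarrow> real^('n + 'm)^('n + 'm)" where
  "Popov Q R S = block_matrix Q S (transpose S) R"

primrec trajectory ::
  "real^'n^'n \<Rightarrow> real^'m^'n \<Rightarrow> real^'n \<Rightarrow> (nat \<Rightarrow> real^'m) \<Rightarrow> nat \<Rightarrow> real^'n" where
  "trajectory A B x0 u 0 = x0"
| "trajectory A B x0 u (Suc t) = A *v trajectory A B x0 u t + B *v u t"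

definition cost ::
  "real^'n^'n \<Rightarrow> real^'m^'n \<Rightarrow> real^'n^'n \<Rightarrow> real^'m^'m \<Rightarrow> real^'m^'n
    \<Rightarrow> real^'n \<Rightarrow> (nat \<Rightarrow> real^'m) \<Rightarrow> ereal" where
  "cost A B Q R S x0 u =
     (\<Sum>t. ereal (stack (trajectory A B x0 u t) (u t) \<bullet>
                 (Popov Q R S *v stack (trajectory A B x0 u t) (u t))))"

definition optimal_control ::
  "real^'n^'n \<Rightarrow> real^'m^'n \<Rightarrow> real^'n^'n \<Rightarrow> real^'m^'m \<Rightarrow> real^'m^'n
    \<Rightarrow> real^'n \<Rightarrow> (nat \<Rightarrow> real^'m) \<Rightarrow> bool" where
  "optimal_control A B Q R S x0 u \<longleftrightarrow> (\<forall>w. cost A B Q R S x0 u \<le> cost A B Q R S x0 w)"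

definition R_of :: "real^'m^'n \<Rightarrow> real^'m^'m \<Rightarrow> real^'n^'n \<Rightarrow> real^'m^'m" where
  "R_of B R X = R + transpose B ** X ** B"

definition S_of :: "real^'n^'n \<Rightarrow> real^'m^'n \<Rightarrow> real^'m^'n \<Rightarrow> real^'n^'n \<Rightarrow> real^'m^'n" where
  "S_of A B S X = transpose A ** X ** B + S"

definition K_of ::
  "real^'n^'n \<Rightarrow> real^'m^'n \<Rightarrow> real^'m^'m \<Rightarrow> real^'m^'n \<Rightarrow> real^'n^'n \<Rightarrow> real^'n^'m" where
  "K_of A B R S X = pinv (R_of B R X) ** transpose (S_of A B S X)"

definition G_of :: "real^'m^'n \<Rightarrow> real^'m^'m \<Rightarrow> real^'n^'n \<Rightarrow> real^'m^'m" where
  "G_of B R X = mat 1 - pinv (R_of B R X) ** R_of B R X"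

definition riccati_op ::
  "real^'n^'n \<Rightarrow> real^'m^'n \<Rightarrow> real^'n^'n \<Rightarrow> real^'m^'m \<Rightarrow> real^'m^'n
    \<Rightarrow> real^'n^'n \<Rightarrow> real^'n^'n" where
  "riccati_op A B Q R S P =
     transpose A ** P ** A
     - (transpose A ** P ** B + S) ** pinv (R + transpose B ** P ** B)
         ** (transpose B ** P ** A + transpose S)
     + Q"

primrec riccati_seq ::
  "real^'n^'n \<Rightarrow> real^'m^'n \<Rightarrow> real^'n^'n \<Rightarrow> real^'m^'m \<Rightarrow> real^'m^'n
    \<Rightarrow> nat \<Rightarrow> real^'n^'n" where
  "riccati_seq A B Q R S 0 = 0"
| "riccati_seq A B Q R S (Suc t) = riccati_op A B Q R S (riccati_seq A B Q R S t)"

definition CGDARE_solution ::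
  "real^'n^'n \<Rightarrow> real^'m^'n \<Rightarrow> real^'n^'n \<Rightarrow> real^'m^'m \<Rightarrow> real^'m^'n
    \<Rightarrow> real^'n^'n \<Rightarrow> bool" where
  "CGDARE_solution A B Q R S X \<longleftrightarrow>
     symmetric X \<and> X = riccati_op A B Q R S X \<and> ker (R_of B R X) \<subseteq> ker (S_of A B S X)"

end

theory Submission
  imports Defs
begin

text \<open>
  For positive semidefinite \<open>X\<close> the function \<open>stage x u + qform X (A x + B u)\<close> is nonnegative,
  which forces \<open>ker (R_of B R X) \<subseteq> ker (S_of A B S X)\<close>; completing the square then shows that the
  Riccati operator is its minimum over \<open>u\<close>. Hence the operator is monotone, the iterates from 0
  increase, and they are bounded by any finite cost, so they converge. The limit is a fixed point
  by a compactness argument for the minimisers. Summing the completed squares along a trajectory,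
  the cost exceeds the quadratic form of the limit by a sum of squares, and the optimal controls
  are those for which every square vanishes.
\<close>

section \<open>Quadratic forms\<close>

definition qform :: "real^'n^'n \<Rightarrow> real^'n \<Rightarrow> real" where
  "qform M x = x \<bullet> (M *v x)"

lemma inner_matrix_vector_mult:
  fixes M :: "real^'n^'m"
  shows "x \<bullet> (M *v y) = (transpose M *v x) \<bullet> y"
  by (simp add: dot_lmul_matrix[symmetric])

lemma inner_symmetric_matrix:
  assumes "symmetric M"
  shows "x \<bullet> (M *v y) = (M *v x) \<bullet> y"
  using assms inner_matrix_vector_mult[of x M y] unfolding symmetric_def by metis

lemma qform_add:
  assumes "symmetric M"
  shows "qform M (x + y) = qform M x + 2 * (x \<bullet> (M *v y)) + qform M y"
proof -
  have "y \<bullet> (M *v x) = x \<bullet> (M *v y)"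
    using inner_symmetric_matrix[OF assms, of y x] by (simp add: inner_commute)
  then show ?thesis
    by (simp add: qform_def matrix_vector_right_distrib inner_add_left inner_add_right)
qed

lemma qform_scaleR: "qform M (c *\<^sub>R x) = c\<^sup>2 * qform M x"
  by (simp add: qform_def matrix_vector_mult_scaleR power2_eq_square)

lemma qform_add_kernel:
  assumes "symmetric M" "M *v k = 0"
  shows "qform M (x + k) = qform M x"
  by (simp add: qform_add assms) (simp add: qform_def assms)

lemma qform_zero: "qform 0 x = 0"
  by (simp add: qform_def)

lemma qform_add_matrix: "qform (X + Y) x = qform X x + qform Y x"
  by (simp add: qform_def matrix_vector_mult_add_rdistrib inner_add_right)

lemma qform_diff_matrix: "qform (X - Y) x = qform X x - qform Y x"
  by (simp add: qform_def matrix_vector_mult_diff_rdistrib inner_diff_right)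

lemma qform_congruence: "qform (transpose C ** X ** C) x = qform X (C *v x)"
  using inner_matrix_vector_mult[of x "transpose C" "X *v (C *v x)"]
  by (simp only: qform_def matrix_vector_mul_assoc[symmetric] transpose_transpose)

lemma pos_semidef_qform: "pos_semidef M \<longleftrightarrow> symmetric M \<and> (\<forall>x. 0 \<le> qform M x)"
  by (simp add: pos_semidef_def qform_def)

lemma symmetric_diff: "symmetric X \<Longrightarrow> symmetric Y \<Longrightarrow> symmetric (X - Y)"
  by (simp add: symmetric_def transpose_def vec_eq_iff)

lemma symmetric_add: "symmetric X \<Longrightarrow> symmetric Y \<Longrightarrow> symmetric (X + Y)"
  by (simp add: symmetric_def transpose_def vec_eq_iff)

lemma symmetric_congruence:
  fixes M :: "real^'n^'n" and C :: "real^'m^'n"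
  shows "symmetric M \<Longrightarrow> symmetric (transpose C ** M ** C)"
  by (simp add: symmetric_def matrix_transpose_mul matrix_mul_assoc)

lemma loewner_le_qform:
  assumes "symmetric X" "symmetric Y"
  shows "X \<preceq> Y \<longleftrightarrow> (\<forall>x. qform X x \<le> qform Y x)"
  using assms
  by (simp add: loewner_le_def pos_semidef_qform symmetric_diff qform_diff_matrix)

section \<open>Kernels and norm bounds for semidefinite forms\<close>

lemma affine_nonneg_imp_slope_zero:
  fixes a b :: real
  assumes "\<And>s. 0 \<le> a + s * b"
  shows "b = 0"
proof (rule ccontr)
  assume "b \<noteq> 0"
  \<comment> \<open>At this point the affine function takes the value -1.\<close>
  then show False using assms[of "- (a + 1) / b"] by simp
qed

text \<open>Along the line \<open>y + s *\<^sub>R x\<close> the quadratic term in \<open>s\<close>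
  vanishes, so the form is affine and nonnegative and its slope must be zero for every
  \<open>y\<close>.\<close>

lemma psd_qform_zero_imp_kernel:
  assumes "pos_semidef M" "qform M x = 0"
  shows "M *v x = 0"
proof -
  have sym: "symmetric M" and nn: "\<And>z. 0 \<le> qform M z"
    using assms(1) by (auto simp: pos_semidef_qform)
  have "0 \<le> qform M y + s * (2 * (y \<bullet> (M *v x)))" for y s
    using nn[of "y + s *\<^sub>R x"] assms(2)
    by (simp add: qform_add[OF sym] qform_scaleR matrix_vector_mult_scaleR mult_ac)
  then have "2 * (y \<bullet> (M *v x)) = 0" for y
    by (rule affine_nonneg_imp_slope_zero)
  from this[of "M *v x"] show ?thesis by simp
qed

text \<open>Nonnegativity at \<open>x - (1/K) M x\<close>, with \<open>K\<close> bounding the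
  operator norm, gives the inequality with \<open>c = K\<close>. It later bounds minimisers modulo
  the kernel.\<close>

lemma psd_norm_sq_le:
  fixes M :: "real^'m^'m"
  assumes "pos_semidef M"
  shows "\<exists>c\<ge>0. \<forall>x. (norm (M *v x))\<^sup>2 \<le> c * qform M x"
proof -
  have sym: "symmetric M" and nn: "\<And>z. 0 \<le> qform M z"
    using assms(1) by (auto simp: pos_semidef_qform)
  obtain K where K: "K > 0" "\<And>z. norm (M *v z) \<le> norm z * K"
    using bounded_linear.pos_bounded[OF matrix_vector_mul_bounded_linear[of M]] by blast
  have qK: "qform M z \<le> K * (norm z)\<^sup>2" for z
  proof -
    have "qform M z \<le> norm z * norm (M *v z)"
      unfolding qform_def by (rule norm_cauchy_schwarz)
    also have "\<dots> \<le> norm z * (norm z * K)"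
      by (intro mult_left_mono K) simp
    finally show ?thesis by (simp add: power2_eq_square mult_ac)
  qed
  have "(norm (M *v x))\<^sup>2 \<le> K * qform M x" for x
  proof -
    let ?y = "M *v x"
    have "0 \<le> qform M (x + (- 1 / K) *\<^sub>R ?y)" by (rule nn)
    also have "\<dots> = qform M x + 2 * (x \<bullet> (M *v ((- 1 / K) *\<^sub>R ?y))) + (- 1 / K)\<^sup>2 * qform M ?y"
      by (simp only: qform_add[OF sym] qform_scaleR)
    also have "x \<bullet> (M *v ((- 1 / K) *\<^sub>R ?y)) = - (norm ?y)\<^sup>2 / K"
      unfolding matrix_vector_mult_scaleR inner_scaleR_right inner_symmetric_matrix[OF sym, of x]
      by (simp add: power2_norm_eq_inner)
    also have "(- 1 / K)\<^sup>2 * qform M ?y \<le> (- 1 / K)\<^sup>2 * (K * (norm ?y)\<^sup>2)"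
      by (intro mult_left_mono qK) simp
    also have "\<dots> = (norm ?y)\<^sup>2 / K"
      using K(1) by (simp add: power2_eq_square field_simps)
    finally show ?thesis using K(1) by (simp add: field_simps)
  qed
  with K(1) show ?thesis by (intro exI[of _ K]) auto
qed

section \<open>Limits of matrices and of their quadratic forms\<close>

lemma tendsto_matrix_vector_mult:
  fixes X :: "'a \<Rightarrow> real^'n^'m"
  assumes "(X \<longlongrightarrow> L) F"
  shows "((\<lambda>t. X t *v x) \<longlongrightarrow> L *v x) F"
  unfolding matrix_vector_mult_def
  by (intro vec_tendstoI, simp, intro tendsto_intros tendsto_vec_nth[OF tendsto_vec_nth] assms)

lemma tendsto_qform:
  assumes "(X \<longlongrightarrow> L) F"
  shows "((\<lambda>t. qform (X t) x) \<longlongrightarrow> qform L x) F"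
  unfolding qform_def by (intro tendsto_intros tendsto_matrix_vector_mult assms)

lemma tendsto_qform_arg:
  assumes "(u \<longlongrightarrow> l) F"
  shows "((\<lambda>t. qform M (u t)) \<longlongrightarrow> qform M l) F"
  unfolding qform_def
  by (intro tendsto_intros assms bounded_linear.tendsto[OF matrix_vector_mul_bounded_linear])

lemma symmetric_eq_qform:
  assumes "symmetric X" "symmetric Y" "\<And>x. qform X x = qform Y x"
  shows "X = Y"
proof -
  have zero: "qform (X - Y) x = 0" for x
    by (simp add: qform_diff_matrix assms(3))
  then have "pos_semidef (X - Y)"
    by (simp add: pos_semidef_qform symmetric_diff assms)
  then have "(X - Y) *v x = 0" for x
    using psd_qform_zero_imp_kernel zero by blast
  then show ?thesis by (simp add: matrix_eq matrix_vector_mult_diff_rdistrib)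
qed

lemma convergent_matrix_from_qform:
  fixes X :: "nat \<Rightarrow> real^'n^'n"
  assumes sym: "\<And>t. symmetric (X t)" and conv: "\<And>x. convergent (\<lambda>t. qform (X t) x)"
  shows "\<exists>L. X \<longlonglongrightarrow> L \<and> symmetric L"
proof -
  \<comment> \<open>Polarisation: the form at basis vectors and their sums determines the
    entries.\<close>
  have entry: "X t $ i $ j =
      (qform (X t) (axis i 1 + axis j 1) - qform (X t) (axis i 1) - qform (X t) (axis j 1)) / 2"
    for t i j
    by (simp add: qform_add[OF sym] inner_axis' matrix_vector_mul_component inner_axis)
  have "convergent (\<lambda>t. X t $ i $ j)" for i j
    unfolding entry divide_inverse
    by (intro convergent_mult convergent_diff convergent_const conv)
  then obtain l where l: "\<And>i j. (\<lambda>t. X t $ i $ j) \<longlonglongrightarrow> l i j"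
    unfolding convergent_def by metis
  have "X \<longlonglongrightarrow> (\<chi> i j. l i j)"
    by (intro vec_tendstoI) (simp add: l)
  moreover have "l i j = l j i" for i j
  proof (rule LIMSEQ_unique[OF l])
    have "X t $ i $ j = X t $ j $ i" for t
      using sym[of t] by (simp add: symmetric_def transpose_def vec_eq_iff)
    then show "(\<lambda>t. X t $ i $ j) \<longlonglongrightarrow> l j i" using l[of j i] by simp
  qed
  then have "symmetric (\<chi> i j. l i j)"
    by (simp add: symmetric_def transpose_def vec_eq_iff)
  ultimately show ?thesis by blast
qed

section \<open>Pseudo-inverse of a symmetric matrix\<close>

text \<open>Both candidates give the same products with \<open>M\<close> on either side, because
  transposing a product of two symmetric factors swaps them. Then
  \<open>N1 = N1 M N1 = N1 M N2 = N2 M N2 = N2\<close>.\<close>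

lemma is_pinv_unique:
  assumes "is_pinv M N1" "is_pinv M N2"
  shows "N1 = N2"
proof -
  have a: "M ** N1 ** M = M" "N1 ** M ** N1 = N1" "transpose (M ** N1) = M ** N1"
      "transpose (N1 ** M) = N1 ** M"
    and b: "M ** N2 ** M = M" "N2 ** M ** N2 = N2" "transpose (M ** N2) = M ** N2"
      "transpose (N2 ** M) = N2 ** M"
    using assms by (auto simp: is_pinv_def symmetric_def)
  have "M ** N1 = transpose ((M ** N2) ** (M ** N1))"
    by (simp add: matrix_mul_assoc b(1) a(3))
  also have "\<dots> = M ** N2"
    by (simp only: matrix_transpose_mul[of "M ** N2" "M ** N1"] a(3) b(3))
       (simp add: matrix_mul_assoc a(1))
  finally have 1: "M ** N1 = M ** N2" .
  have "N1 ** M = transpose ((N1 ** M) ** (N2 ** M))"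
    by (metis matrix_mul_assoc b(1) a(4))
  also have "\<dots> = N2 ** M"
    by (simp only: matrix_transpose_mul[of "N1 ** M" "N2 ** M"] a(4) b(4))
       (metis matrix_mul_assoc a(1))
  finally have 2: "N1 ** M = N2 ** M" .
  have "N1 = N1 ** (M ** N1)" by (simp add: matrix_mul_assoc a(2))
  also have "\<dots> = N1 ** M ** N2" by (simp add: 1 matrix_mul_assoc)
  also have "\<dots> = N2" by (simp add: 2 b(2))
  finally show ?thesis .
qed

text \<open>As \<open>M\<close> is symmetric, it vanishes on the complement of its range, so \<open>M\<close> and
  \<open>M ** M\<close> have the same range. From \<open>M = M ** M ** W\<close> the projection onto that range
  is \<open>M ** W\<close>, which gives the pseudo-inverse without spectral theory.\<close>

lemma symmetric_factor_square:
  fixes M :: "real^'n^'n"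
  assumes "symmetric M"
  shows "\<exists>W. M ** M ** W = M"
proof -
  have "\<exists>z. M *v (M *v z) = M *v x" for x
  proof -
    have "subspace (range ((*v) M))"
      by (rule linear_subspace_image[OF matrix_vector_mul_linear subspace_UNIV])
    then obtain a b where ab: "a \<in> range ((*v) M)" "\<And>w. w \<in> range ((*v) M) \<Longrightarrow> orthogonal b w"
        "x = a + b"
      using orthogonal_subspace_decomp_exists[of "range ((*v) M)" x]
      by (metis span_eq_iff)
    have "(M *v b) \<bullet> (M *v b) = b \<bullet> (M *v (M *v b))"
      by (simp add: inner_symmetric_matrix[OF assms, of b])
    also have "\<dots> = 0" using ab(2)[of "M *v (M *v b)"] by (simp add: orthogonal_def)
    finally have "M *v b = 0" by simp
    then show ?thesis using ab(1,3) by (auto simp: matrix_vector_right_distrib)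
  qed
  then obtain z where z: "\<And>x. M *v (M *v z x) = M *v x" by metis
  \<comment> \<open>The choice function \<open>z\<close> need not be linear, so the matrix is built
    from its values on the basis vectors.\<close>
  define W :: "real^'n^'n" where "W = (\<chi> i j. z (axis j 1) $ i)"
  have "W *v axis j 1 = z (axis j 1)" for j
    by (simp add: W_def matrix_vector_mult_basis column_def)
  then have "(M ** M ** W) *v axis j 1 = M *v axis j 1" for j
    by (simp add: matrix_vector_mul_assoc[symmetric] z)
  then have "column j (M ** M ** W) = column j M" for j
    by (simp add: matrix_vector_mult_basis)
  then have "M ** M ** W = M"
    by (simp add: column_def vec_eq_iff)
  then show ?thesis by blast
qed

lemma symmetric_has_pinv:
  fixes M :: "real^'n^'n"
  assumes "symmetric M"
  shows "\<exists>N. is_pinv M N"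
proof -
  have tM: "transpose M = M" using assms by (simp add: symmetric_def)
  obtain W where W: "M ** M ** W = M" using symmetric_factor_square[OF assms] by blast
  have W': "transpose W ** M ** M = M"
    using arg_cong[OF W, of transpose] by (simp add: matrix_transpose_mul tM matrix_mul_assoc)
  define P where "P = M ** W"
  have P': "P = transpose W ** M"
    unfolding P_def by (metis W W' matrix_mul_assoc)
  have tP: "transpose P = P"
    by (subst P_def) (simp add: matrix_transpose_mul tM P')
  have PM: "P ** M = M" by (simp add: P' W')
  have MP: "M ** P = M" by (simp add: P_def matrix_mul_assoc W)
  have PP: "P ** P = P"
    by (metis PM P_def matrix_mul_assoc)
  \<comment> \<open>Compressing \<open>W\<close> by the projection on both sides makes
    \<open>M N\<close> and \<open>N M\<close> equal to \<open>P\<close>.\<close>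
  define N where "N = P ** W ** P"
  have MN: "M ** N = P"
    unfolding N_def by (metis MP P_def PP matrix_mul_assoc)
  have PWM: "P ** W ** M = P"
  proof -
    have "P ** W ** M = transpose W ** (M ** W ** M)"
      by (simp add: P' matrix_mul_assoc)
    also have "\<dots> = P" using PM by (simp add: P_def[symmetric] P')
    finally show ?thesis .
  qed
  have NM: "N ** M = P"
    unfolding N_def by (metis PM PWM matrix_mul_assoc)
  have PN: "P ** N = N" by (simp add: N_def matrix_mul_assoc PP)
  have "is_pinv M N"
    by (simp add: is_pinv_def symmetric_def MN NM tP PM PN)
  then show ?thesis by blast
qed

lemma is_pinv_pinv: "symmetric M \<Longrightarrow> is_pinv M (pinv M)"
  unfolding pinv_def using symmetric_has_pinv is_pinv_unique by (metis theI)

text \<open>Transposing the Penrose equations of a symmetric matrix shows that the transposed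
  inverse solves them too; uniqueness does the rest.\<close>

lemma symmetric_pinv:
  assumes "symmetric M"
  shows "symmetric (pinv M)"
proof -
  have p: "is_pinv M (pinv M)" by (rule is_pinv_pinv[OF assms])
  have tM: "transpose M = M" using assms by (simp add: symmetric_def)
  have "is_pinv M (transpose (pinv M))"
    unfolding is_pinv_def symmetric_def
  proof (intro conjI)
    let ?N = "pinv M"
    have *: "M ** ?N ** M = M" "?N ** M ** ?N = ?N" "transpose (M ** ?N) = M ** ?N"
        "transpose (?N ** M) = ?N ** M"
      using p by (auto simp: is_pinv_def symmetric_def)
    show "M ** transpose ?N ** M = M"
      using arg_cong[OF *(1), of transpose] by (simp add: matrix_transpose_mul tM matrix_mul_assoc)
    show "transpose ?N ** M ** transpose ?N = transpose ?N"
      using arg_cong[OF *(2), of transpose] by (simp add: matrix_transpose_mul tM matrix_mul_assoc)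
    show "transpose (M ** transpose ?N) = M ** transpose ?N"
      using *(4) by (simp add: matrix_transpose_mul tM)
    show "transpose (transpose ?N ** M) = transpose ?N ** M"
      using *(3) by (simp add: matrix_transpose_mul tM)
  qed
  from is_pinv_unique[OF this p] show ?thesis by (simp add: symmetric_def)
qed

text \<open>The vector \<open>pinv M (M u) - u\<close> lies in the kernel of \<open>M\<close>, hence
  in that of \<open>Z\<close>.\<close>

lemma pinv_mult_kernel:
  assumes "symmetric M" "ker M \<subseteq> ker Z"
  shows "Z ** pinv M ** M = Z"
proof -
  have p: "M ** pinv M ** M = M" using is_pinv_pinv[OF assms(1)] by (simp add: is_pinv_def)
  have "(Z ** pinv M ** M) *v u = Z *v u" for u
  proof -
    have "M *v (pinv M *v (M *v u) - u) = 0"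
      by (simp add: matrix_vector_mult_diff_distrib matrix_vector_mul_assoc matrix_mul_assoc p)
    then have "Z *v (pinv M *v (M *v u) - u) = 0"
      using assms(2) by (auto simp: ker_def)
    then show ?thesis
      by (simp add: matrix_vector_mult_diff_distrib matrix_vector_mul_assoc matrix_mul_assoc)
  qed
  then show ?thesis by (simp add: matrix_eq)
qed

text \<open>The kernel inclusion gives \<open>M ** pinv M ** transpose Z = transpose Z\<close>, so
  the shift produces exactly the cross term even when \<open>M\<close> is singular.\<close>

lemma complete_square:
  fixes M :: "real^'m^'m" and Z :: "real^'m^'n"
  assumes "symmetric M" "ker M \<subseteq> ker Z"
  shows "qform M (u + (pinv M ** transpose Z) *v x)
    = qform M u + 2 * (x \<bullet> (Z *v u)) + qform (Z ** pinv M ** transpose Z) x"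
proof -
  let ?N = "pinv M"
  have tM: "transpose M = M" and tN: "transpose ?N = ?N"
    using assms(1) symmetric_pinv[OF assms(1)] by (auto simp: symmetric_def)
  have z: "M ** ?N ** transpose Z = transpose Z"
    using arg_cong[OF pinv_mult_kernel[OF assms], of transpose]
    by (simp add: matrix_transpose_mul tM tN matrix_mul_assoc)
  have MN: "M *v ((?N ** transpose Z) *v x) = transpose Z *v x"
    by (simp add: matrix_vector_mul_assoc matrix_mul_assoc z)
  have "qform M ((?N ** transpose Z) *v x) = ((?N ** transpose Z) *v x) \<bullet> (transpose Z *v x)"
    by (simp add: qform_def MN)
  also have "\<dots> = qform (Z ** ?N ** transpose Z) x"
    unfolding qform_def
    using inner_matrix_vector_mult[of x Z "(?N ** transpose Z) *v x"]
    by (simp add: matrix_vector_mul_assoc matrix_mul_assoc inner_commute)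
  finally show ?thesis
    using inner_matrix_vector_mult[of x Z u]
    by (simp add: qform_add[OF assms(1)] MN inner_commute)
qed

section \<open>The Bellman operator\<close>

lemma sum_UNIV_Plus:
  fixes f :: "'a::finite + 'b::finite \<Rightarrow> 'c::comm_monoid_add"
  shows "(\<Sum>i\<in>UNIV. f i) = (\<Sum>a\<in>UNIV. f (Inl a)) + (\<Sum>b\<in>UNIV. f (Inr b))"
  unfolding UNIV_Plus_UNIV[symmetric] by (subst sum.Plus) simp_all

lemma transpose_add: "transpose (X + Y) = transpose X + transpose Y"
  by (simp add: transpose_def vec_eq_iff)

lemma inner_stack: "stack x u \<bullet> stack y v = x \<bullet> y + u \<bullet> v"
  by (simp add: inner_vec_def stack_def sum_UNIV_Plus)

lemma block_matrix_mult_stack: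
  "block_matrix M11 M12 M21 M22 *v stack x u = stack (M11 *v x + M12 *v u) (M21 *v x + M22 *v u)"
  by (auto simp: vec_eq_iff matrix_vector_mult_def block_matrix_def stack_def sum_UNIV_Plus
      split: sum.split)

lemma qform_Popov:
  "qform (Popov Q R S) (stack x u) = qform Q x + 2 * (x \<bullet> (S *v u)) + qform R u"
  using inner_matrix_vector_mult[of x S u]
  by (simp add: qform_def Popov_def block_matrix_mult_stack inner_stack inner_add_right inner_commute)

section \<open>One-step minimisation and the Riccati operator\<close>

locale lq_problem =
  fixes A :: "real^'n^'n" and B :: "real^'m^'n"
    and Q :: "real^'n^'n" and R :: "real^'m^'m" and S :: "real^'m^'n"
  assumes symQ: "symmetric Q" and symR: "symmetric R"
    and psd_Popov: "pos_semidef (Popov Q R S)"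
begin

definition stage :: "real^'n \<Rightarrow> real^'m \<Rightarrow> real" where
  "stage x u = qform (Popov Q R S) (stack x u)"

text \<open>The cost of one step followed by the terminal penalty \<open>X\<close>.\<close>

definition bellman :: "real^'n^'n \<Rightarrow> real^'n \<Rightarrow> real^'m \<Rightarrow> real" where
  "bellman X x u = stage x u + qform X (A *v x + B *v u)"

abbreviation "ric \<equiv> riccati_op A B Q R S"
abbreviation "RX \<equiv> R_of B R"
abbreviation "SX \<equiv> S_of A B S"
abbreviation "KX \<equiv> K_of A B R S"

lemma stage_nonneg: "0 \<le> stage x u"
  using psd_Popov by (simp add: stage_def pos_semidef_qform)

lemma bellman_nonneg: "pos_semidef X \<Longrightarrow> 0 \<le> bellman X x u"
  by (simp add: bellman_def stage_nonneg pos_semidef_qform)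

lemma symmetric_RX: "symmetric X \<Longrightarrow> symmetric (RX X)"
  by (simp add: R_of_def symmetric_add symR symmetric_congruence)

lemma bellman_expand:
  assumes "symmetric X"
  shows "bellman X x u
    = qform (transpose A ** X ** A + Q) x + 2 * (x \<bullet> (SX X *v u)) + qform (RX X) u"
proof -
  have "x \<bullet> (transpose A *v (X *v (B *v u))) = (A *v x) \<bullet> (X *v (B *v u))"
    using inner_matrix_vector_mult[of x "transpose A" "X *v (B *v u)"]
    by (simp only: transpose_transpose)
  then show ?thesis
    unfolding bellman_def stage_def qform_Popov qform_add[OF assms] qform_add_matrix R_of_def S_of_def
      qform_congruence matrix_vector_mult_add_rdistrib inner_add_right
    by (simp add: matrix_vector_mul_assoc[symmetric] del: transpose_matrix_vector)
qed

lemma psd_RX: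
  assumes "pos_semidef X"
  shows "pos_semidef (RX X)"
proof -
  have sym: "symmetric X" using assms by (simp add: pos_semidef_def)
  have "qform (RX X) u = bellman X 0 u" for u
    by (simp add: bellman_expand[OF sym]) (simp add: qform_def)
  then show ?thesis
    using bellman_nonneg[OF assms] symmetric_RX[OF sym] by (simp add: pos_semidef_qform)
qed

text \<open>For \<open>v\<close> in the kernel of \<open>RX X\<close>, the nonnegative function
  \<open>bellman X x (s *\<^sub>R v)\<close> is affine in \<open>s\<close>, so its slope, twice
  \<open>x \<bullet> (SX X *v v)\<close>, vanishes for all \<open>x\<close>.\<close>

lemma ker_RX_subset:
  assumes "pos_semidef X"
  shows "ker (RX X) \<subseteq> ker (SX X)"
proof
  fix v assume "v \<in> ker (RX X)"
  then have v: "RX X *v v = 0" by (simp add: ker_def)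
  have sym: "symmetric X" using assms by (simp add: pos_semidef_def)
  have "0 \<le> qform (transpose A ** X ** A + Q) x + s * (2 * (x \<bullet> (SX X *v v)))" for x s
  proof -
    have "qform (RX X) (s *\<^sub>R v) = 0"
      by (simp add: qform_scaleR) (simp add: qform_def v)
    with bellman_nonneg[OF assms, of x "s *\<^sub>R v"] show ?thesis
      by (simp add: bellman_expand[OF sym] matrix_vector_mult_scaleR mult_ac)
  qed
  then have "2 * (x \<bullet> (SX X *v v)) = 0" for x
    by (rule affine_nonneg_imp_slope_zero)
  from this[of "SX X *v v"] show "v \<in> ker (SX X)" by (simp add: ker_def)
qed

lemma riccati_alt:
  assumes "symmetric X"
  shows "ric X = transpose A ** X ** A + Q - SX X ** pinv (RX X) ** transpose (SX X)"
proof -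
  have "transpose (SX X) = transpose B ** X ** A + transpose S"
    using assms
    by (simp add: S_of_def transpose_add matrix_transpose_mul symmetric_def matrix_mul_assoc)
  then show ?thesis by (simp add: riccati_op_def S_of_def R_of_def)
qed

text \<open>An identity for every input, not only the minimiser \<open>- (KX X *v x)\<close>: the
  square measures the excess, which is later summed along trajectories.\<close>

lemma bellman_square:
  assumes "pos_semidef X"
  shows "bellman X x u = qform (ric X) x + qform (RX X) (u + KX X *v x)"
proof -
  have sym: "symmetric X" using assms by (simp add: pos_semidef_def)
  show ?thesis
    unfolding K_of_def complete_square[OF symmetric_RX[OF sym] ker_RX_subset[OF assms]]
      riccati_alt[OF sym] qform_diff_matrix bellman_expand[OF sym]
    by simp
qed

lemma riccati_le_bellman: "pos_semidef X \<Longrightarrow> qform (ric X) x \<le> bellman X x u"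
  using psd_RX[of X] by (simp add: bellman_square pos_semidef_qform)

lemma riccati_attained: "pos_semidef X \<Longrightarrow> bellman X x (- (KX X *v x)) = qform (ric X) x"
  by (simp add: bellman_square) (simp add: qform_def)

lemma psd_riccati:
  assumes "pos_semidef X"
  shows "pos_semidef (ric X)"
proof -
  have sym: "symmetric X" using assms by (simp add: pos_semidef_def)
  have "symmetric (ric X)"
    using symmetric_congruence[OF symmetric_pinv[OF symmetric_RX[OF sym]], of "transpose (SX X)"]
    by (simp add: riccati_alt sym symmetric_diff symmetric_add symQ symmetric_congruence)
  then show ?thesis
    using riccati_attained[OF assms] bellman_nonneg[OF assms]
    by (metis pos_semidef_qform)
qed

text \<open>The minimiser for \<open>Y\<close> is an admissible, possibly suboptimal, input for
  \<open>X\<close>.\<close>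

lemma riccati_mono:
  assumes "pos_semidef X" "pos_semidef Y" "\<And>x. qform X x \<le> qform Y x"
  shows "qform (ric X) x \<le> qform (ric Y) x"
proof -
  have "qform (ric X) x \<le> bellman X x (- (KX Y *v x))"
    by (rule riccati_le_bellman[OF assms(1)])
  also have "\<dots> \<le> bellman Y x (- (KX Y *v x))"
    by (simp add: bellman_def assms(3))
  finally show ?thesis by (simp add: riccati_attained assms(2))
qed

section \<open>Monotonicity of the iterates from zero\<close>

abbreviation "Xseq \<equiv> riccati_seq A B Q R S"

lemma psd_riccati_seq: "pos_semidef (Xseq t)"
proof (induction t)
  case 0
  then show ?case by (simp add: pos_semidef_def symmetric_def transpose_def vec_eq_iff)
qed (simp add: psd_riccati)

lemma riccati_seq_Suc: "qform (Xseq t) x \<le> qform (Xseq (Suc t)) x"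
proof (induction t arbitrary: x)
  case 0
  then show ?case using psd_riccati_seq[of 1] by (simp add: qform_zero pos_semidef_qform)
next
  case (Suc t)
  show ?case
    using riccati_mono[OF psd_riccati_seq psd_riccati_seq Suc] by simp
qed

lemma riccati_seq_mono: "s \<le> t \<Longrightarrow> qform (Xseq s) x \<le> qform (Xseq t) x"
  by (rule lift_Suc_mono_le[of "\<lambda>t. qform (Xseq t) x"]) (simp_all add: riccati_seq_Suc del: riccati_seq.simps)

text \<open>Induction from \<open>0\<close> below \<open>Y\<close>: applying the monotone operator
  to both sides leaves \<open>Y\<close> fixed.\<close>

lemma riccati_seq_le_solution:
  assumes "pos_semidef Y" "Y = ric Y"
  shows "qform (Xseq t) x \<le> qform Y x"
proof (induction t arbitrary: x)
  case 0
  then show ?case using assms(1) by (simp add: qform_zero pos_semidef_qform)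
next
  case (Suc t)
  show ?case
    using riccati_mono[OF psd_riccati_seq assms(1) Suc, of x] assms(2) by simp
qed

section \<open>Iterates and the cost along trajectories\<close>

abbreviation "traj \<equiv> trajectory A B"

text \<open>Dynamic programming: each Riccati step accounts for the first remaining stage. The
  starting time is arbitrary both because the induction advances it and because cost tails are
  estimated later.\<close>

lemma finite_horizon_lower_bound:
  "qform (Xseq N) (traj x0 u T) \<le> (\<Sum>t\<in>{T..<T+N}. stage (traj x0 u t) (u t))"
proof (induction N arbitrary: T)
  case 0
  then show ?case by (simp add: qform_zero)
next
  case (Suc N)
  have "qform (Xseq (Suc N)) (traj x0 u T) \<le> bellman (Xseq N) (traj x0 u T) (u T)"
    using riccati_le_bellman[OF psd_riccati_seq] by simp
  also have "\<dots> = stage (traj x0 u T) (u T) + qform (Xseq N) (traj x0 u (Suc T))"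
    by (simp add: bellman_def)
  also have "\<dots> \<le> stage (traj x0 u T) (u T)
      + (\<Sum>t\<in>{Suc T..<Suc T+N}. stage (traj x0 u t) (u t))"
    using Suc[of "Suc T"] by simp
  also have "\<dots> = (\<Sum>t\<in>{T..<T+Suc N}. stage (traj x0 u t) (u t))"
    by (simp add: sum.atLeast_Suc_lessThan)
  finally show ?case .
qed

lemma cost_stage: "cost A B Q R S x0 u = (\<Sum>t. ereal (stage (traj x0 u t) (u t)))"
  by (simp add: cost_def stage_def qform_def)

lemma partial_cost_le: "ereal (\<Sum>t<T. stage (traj x0 u t) (u t)) \<le> cost A B Q R S x0 u"
  unfolding cost_stage sum_ereal[symmetric]
  by (rule suminf_upper) (simp add: stage_nonneg)

lemma cost_le:
  assumes "\<And>T. (\<Sum>t<T. stage (traj x0 u t) (u t)) \<le> c"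
  shows "cost A B Q R S x0 u \<le> ereal c"
  unfolding cost_stage
  by (rule suminf_bound) (use assms stage_nonneg in auto)

end

section \<open>The limit of the Riccati iteration\<close>

locale lq_finite = lq_problem A B Q R S
  for A :: "real^'n^'n" and B :: "real^'m^'n"
    and Q :: "real^'n^'n" and R :: "real^'m^'m" and S :: "real^'m^'n" +
  assumes finite_cost: "\<And>x0. \<exists>u. cost A B Q R S x0 u < \<infinity>"
begin

lemma riccati_seq_bounded: "\<exists>c. \<forall>t. qform (Xseq t) x \<le> c"
proof -
  obtain u where u: "cost A B Q R S x u < \<infinity>" using finite_cost by blast
  have le: "ereal (qform (Xseq t) x) \<le> cost A B Q R S x u" for t
  proof -
    have "qform (Xseq t) x \<le> (\<Sum>i<t. stage (traj x u i) (u i))"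
      using finite_horizon_lower_bound[of t x u 0] by (simp add: atLeast0LessThan)
    then show ?thesis by (intro order_trans[OF _ partial_cost_le[of x u t]]) simp
  qed
  \<comment> \<open>Together with finiteness from above, this makes the extended real cost a real
    number.\<close>
  have "0 \<le> cost A B Q R S x u"
    using partial_cost_le[of x u 0] by (simp add: zero_ereal_def)
  with u obtain c where "cost A B Q R S x u = ereal c"
    by (cases "cost A B Q R S x u") auto
  with le show ?thesis by auto
qed

lemma riccati_seq_convergent: "\<exists>L. Xseq \<longlonglongrightarrow> L \<and> symmetric L"
proof (rule convergent_matrix_from_qform)
  show "symmetric (Xseq t)" for t using psd_riccati_seq[of t] by (simp add: pos_semidef_def)
  show "convergent (\<lambda>t. qform (Xseq t) x)" for x
  proof -
    obtain c where c: "\<forall>t. qform (Xseq t) x \<le> c" using riccati_seq_bounded by blast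
    have "incseq (\<lambda>t. qform (Xseq t) x)"
      using riccati_seq_mono by (simp add: incseq_def)
    then obtain L where "(\<lambda>t. qform (Xseq t) x) \<longlonglongrightarrow> L"
      by (rule incseq_convergent[OF _ c])
    then show ?thesis by (rule convergentI)
  qed
qed

definition Xbar :: "real^'n^'n" where
  "Xbar = lim Xseq"

lemma Xseq_tendsto: "Xseq \<longlonglongrightarrow> Xbar"
  unfolding Xbar_def using riccati_seq_convergent convergent_LIMSEQ_iff convergentI by blast

lemma symmetric_Xbar: "symmetric Xbar"
  using riccati_seq_convergent LIMSEQ_unique[OF Xseq_tendsto] by blast

lemma qform_Xseq_tendsto: "(\<lambda>t. qform (Xseq t) x) \<longlonglongrightarrow> qform Xbar x"
  by (rule tendsto_qform[OF Xseq_tendsto])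

lemma Xseq_le_Xbar: "qform (Xseq t) x \<le> qform Xbar x"
  using incseq_le[OF _ qform_Xseq_tendsto] riccati_seq_mono by (simp add: incseq_def)

lemma psd_Xbar: "pos_semidef Xbar"
  using Xseq_le_Xbar[of 0] symmetric_Xbar by (simp add: pos_semidef_qform qform_zero)

section \<open>The limit is a fixed point\<close>

lemma ker_RX_antimono:
  assumes "s \<le> t"
  shows "ker (RX (Xseq t)) \<subseteq> ker (RX (Xseq s))"
proof
  fix v assume v: "v \<in> ker (RX (Xseq t))"
  have eq: "qform (RX (Xseq i)) v = bellman (Xseq i) 0 v" for i
    using psd_riccati_seq[of i]
    by (simp add: bellman_expand pos_semidef_def) (simp add: qform_def)
  \<comment> \<open>The forms increase with the index, so a zero of the later one is a zero of the
    earlier one.\<close>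
  have "qform (RX (Xseq s)) v \<le> qform (RX (Xseq t)) v"
    unfolding eq by (simp add: bellman_def riccati_seq_mono assms)
  also have "\<dots> = 0" using v by (simp add: qform_def ker_def)
  finally have "qform (RX (Xseq s)) v = 0"
    using psd_RX[OF psd_riccati_seq, of s] by (simp add: pos_semidef_qform antisym)
  then show "v \<in> ker (RX (Xseq s))"
    using psd_qform_zero_imp_kernel[OF psd_RX[OF psd_riccati_seq]] by (simp add: ker_def)
qed

lemma ker_RX_stabilises: "\<exists>T. \<forall>t\<ge>T. ker (RX (Xseq t)) = ker (RX (Xseq T))"
proof -
  define d where "d t = dim (ker (RX (Xseq t)))" for t
  obtain T where T: "\<And>t. d T \<le> d t"
    using ex_has_least_nat[of "\<lambda>_. True" 0 d] by auto
  have sub: "subspace (ker M)" for M :: "real^'m^'m"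
    by (auto simp: ker_def subspace_def matrix_vector_right_distrib matrix_vector_mult_scaleR)
  have "ker (RX (Xseq t)) = ker (RX (Xseq T))" if "t \<ge> T" for t
    using subspace_dim_equal[OF sub sub ker_RX_antimono[OF that]] T[of t] by (simp add: d_def)
  then show ?thesis by blast
qed

text \<open>The pseudo-inverse is not continuous, so the limit cannot be taken in the recursion itself.
  Instead the minimisers at stage \<open>t\<close> are moved along the eventually constant kernel
  of \<open>R_of B R (Xseq t)\<close> into a bounded set, where a subsequence converges.\<close>

lemma bellman_Xbar_attained: "\<exists>u. bellman Xbar x u \<le> qform Xbar x"
proof -
  obtain T where T: "\<And>t. t \<ge> T \<Longrightarrow> ker (RX (Xseq t)) = ker (RX (Xseq T))"
    using ker_RX_stabilises by blast
  define R0 where "R0 = RX (Xseq T)"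
  have psd0: "pos_semidef R0" unfolding R0_def by (rule psd_RX[OF psd_riccati_seq])
  have R0pinv: "R0 *v (pinv R0 *v (R0 *v w)) = R0 *v w" for w
    using is_pinv_pinv[of R0] psd0
    by (simp add: is_pinv_def pos_semidef_def matrix_vector_mul_assoc matrix_mul_assoc)
  \<comment> \<open>The square at stage \<open>T\<close> is centred at \<open>- k\<close>.
    Projecting \<open>u t + k\<close> onto the range of \<open>R0\<close> and shifting back changes
    \<open>u t\<close> only by an element of the kernel of \<open>R0\<close>.\<close>
  define k where "k = KX (Xseq T) *v x"
  define u where "u t = - (KX (Xseq t) *v x)" for t
  define w where "w t = pinv R0 *v (R0 *v (u t + k))" for t
  define v where "v t = w t - k" for t
  \<comment> \<open>The minimum at stage \<open>t\<close> is the form of the iterate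
    \<open>Suc t\<close>, which lies below the limit.\<close>
  have bell_u: "bellman (Xseq t) x (u t) \<le> qform Xbar x" for t
    using riccati_attained[OF psd_riccati_seq, of t x] Xseq_le_Xbar[of "Suc t" x]
    by (simp add: u_def)
  have bell_mono: "bellman (Xseq s) x z \<le> bellman (Xseq t) x z" if "s \<le> t" for s t z
    by (simp add: bellman_def riccati_seq_mono that)
  have bell_v: "bellman (Xseq t) x (v t) \<le> qform Xbar x" if t: "t \<ge> T" for t
  proof -
    have "v t - u t \<in> ker R0"
      using R0pinv[of "u t + k"]
      by (simp add: ker_def v_def w_def matrix_vector_mult_diff_distrib
          matrix_vector_right_distrib)
    then have ker: "RX (Xseq t) *v (v t - u t) = 0"
      using T[OF t] unfolding R0_def ker_def by blast
    have sym: "symmetric (RX (Xseq t))"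
      using psd_RX[OF psd_riccati_seq, of t] by (simp add: pos_semidef_def)
    have "v t + KX (Xseq t) *v x = (u t + KX (Xseq t) *v x) + (v t - u t)" by simp
    then have "bellman (Xseq t) x (v t) = bellman (Xseq t) x (u t)"
      unfolding bellman_square[OF psd_riccati_seq] by (simp only: qform_add_kernel[OF sym ker])
    then show ?thesis using bell_u by simp
  qed
  \<comment> \<open>The stage \<open>T\<close> square at \<open>u t\<close> is at most its
    \<open>bellman\<close> value there, which grows with the stage and so stays below
    \<open>qform Xbar x\<close>. This bounds \<open>R0 *v (u t + k)\<close>, and applying
    \<open>pinv R0\<close> bounds \<open>w t\<close>.\<close>
  have "bounded (range (\<lambda>t. v (t + T)))"
  proof -
    obtain c where c: "c \<ge> 0" "\<And>z. (norm (R0 *v z))\<^sup>2 \<le> c * qform R0 z"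
      using psd_norm_sq_le[OF psd0] by blast
    obtain K where K: "K > 0" "\<And>z. norm (pinv R0 *v z) \<le> norm z * K"
      using bounded_linear.pos_bounded[OF matrix_vector_mul_bounded_linear[of "pinv R0"]] by blast
    have "norm (v t) \<le> sqrt (c * qform Xbar x) * K + norm k" if t: "t \<ge> T" for t
    proof -
      have "0 \<le> qform (ric (Xseq T)) x"
        using psd_riccati[OF psd_riccati_seq] by (simp add: pos_semidef_qform)
      then have "qform R0 (u t + k) \<le> bellman (Xseq T) x (u t)"
        by (simp add: bellman_square[OF psd_riccati_seq] R0_def k_def)
      also have "\<dots> \<le> qform Xbar x"
        using bell_mono[OF t] bell_u order_trans by blast
      finally have "(norm (R0 *v (u t + k)))\<^sup>2 \<le> c * qform Xbar x"
        using mult_left_mono[OF _ c(1)] order_trans[OF c(2)] by blast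
      then have "norm (R0 *v (u t + k)) \<le> sqrt (c * qform Xbar x)"
        by (rule real_le_rsqrt)
      then have "norm (w t) \<le> sqrt (c * qform Xbar x) * K"
        unfolding w_def using K(1) order_trans[OF K(2)] by (simp add: mult_right_mono)
      then show ?thesis
        unfolding v_def using norm_triangle_ineq4[of "w t" k] by linarith
    qed
    then show ?thesis unfolding bounded_iff by (intro exI[of _ "sqrt (c * qform Xbar x) * K + norm k"]) auto
  qed
  then obtain l r where r: "strict_mono r" and "((\<lambda>t. v (t + T)) \<circ> r) \<longlonglongrightarrow> l"
    using bounded_imp_convergent_subsequence by blast
  then have l: "(\<lambda>j. v (r j + T)) \<longlonglongrightarrow> l" by (simp add: o_def)
  \<comment> \<open>Two limits in succession: first the inputs converge with the stage
    \<open>s\<close> fixed, then \<open>s\<close> tends to infinity with the input \<open>l\<close>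
    fixed.\<close>
  have "bellman (Xseq s) x l \<le> qform Xbar x" for s
  proof (rule LIMSEQ_le_const2)
    show "(\<lambda>j. bellman (Xseq s) x (v (r j + T))) \<longlonglongrightarrow> bellman (Xseq s) x l"
      unfolding bellman_square[OF psd_riccati_seq]
      by (intro tendsto_intros tendsto_qform_arg l)
    have "bellman (Xseq s) x (v (r j + T)) \<le> qform Xbar x" if "j \<ge> s" for j
    proof -
      have "s \<le> r j + T" using seq_suble[OF r, of j] that by linarith
      then show ?thesis using order_trans[OF bell_mono bell_v[of "r j + T"]] by simp
    qed
    then show "\<exists>N. \<forall>j\<ge>N. bellman (Xseq s) x (v (r j + T)) \<le> qform Xbar x" by blast
  qed
  moreover have "(\<lambda>s. bellman (Xseq s) x l) \<longlonglongrightarrow> bellman Xbar x l"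
    unfolding bellman_def by (intro tendsto_intros qform_Xseq_tendsto)
  ultimately have "bellman Xbar x l \<le> qform Xbar x"
    by (intro LIMSEQ_le_const2) auto
  then show ?thesis by blast
qed

text \<open>The limiting minimiser gives one inequality; the other is the limit of
  \<open>ric (Xseq n) \<le> ric Xbar\<close> as forms, which follows from monotonicity.\<close>

lemma Xbar_fixpoint: "ric Xbar = Xbar"
proof (rule symmetric_eq_qform)
  show "symmetric (ric Xbar)" using psd_riccati[OF psd_Xbar] by (simp add: pos_semidef_def)
  show "symmetric Xbar" by (rule symmetric_Xbar)
  fix x
  have "qform (ric Xbar) x \<le> qform Xbar x"
    using bellman_Xbar_attained riccati_le_bellman[OF psd_Xbar] order_trans by blast
  moreover have "qform Xbar x \<le> qform (ric Xbar) x"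
  proof (rule LIMSEQ_le_const2[OF LIMSEQ_Suc[OF qform_Xseq_tendsto]])
    show "\<exists>N. \<forall>n\<ge>N. qform (Xseq (Suc n)) x \<le> qform (ric Xbar) x"
      using riccati_mono[OF psd_riccati_seq psd_Xbar Xseq_le_Xbar] by auto
  qed
  ultimately show "qform (ric Xbar) x = qform Xbar x" by simp
qed

lemma CGDARE_Xbar: "CGDARE_solution A B Q R S Xbar"
  by (simp add: CGDARE_solution_def symmetric_Xbar Xbar_fixpoint ker_RX_subset psd_Xbar)

lemma Xbar_minimal:
  assumes "pos_semidef Y" "CGDARE_solution A B Q R S Y"
  shows "Xbar \<preceq> Y"
proof -
  have Y: "symmetric Y" "Y = ric Y" using assms(2) unfolding CGDARE_solution_def by blast+
  have "qform Xbar x \<le> qform Y x" for x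
    by (rule LIMSEQ_le_const2[OF qform_Xseq_tendsto])
       (use riccati_seq_le_solution[OF assms(1) Y(2)] in auto)
  then show ?thesis by (simp add: loewner_le_qform symmetric_Xbar Y(1))
qed

section \<open>Optimal cost and optimal controls\<close>

lemma cost_lower_bound:
  "ereal ((\<Sum>t<T. stage (traj x0 u t) (u t)) + qform Xbar (traj x0 u T)) \<le> cost A B Q R S x0 u"
proof (rule LIMSEQ_le_const2)
  let ?c = "\<lambda>t. stage (traj x0 u t) (u t)"
  show "(\<lambda>N. ereal ((\<Sum>t<T. ?c t) + qform (Xseq N) (traj x0 u T)))
      \<longlonglongrightarrow> ereal ((\<Sum>t<T. ?c t) + qform Xbar (traj x0 u T))"
    by (intro tendsto_intros qform_Xseq_tendsto)
  have "ereal ((\<Sum>t<T. ?c t) + qform (Xseq N) (traj x0 u T)) \<le> cost A B Q R S x0 u" for N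
  proof -
    \<comment> \<open>The next \<open>N\<close> stages after \<open>T\<close> cost at least the form
      of the \<open>N\<close>-th iterate at the current state.\<close>
    have "(\<Sum>t<T. ?c t) + qform (Xseq N) (traj x0 u T) \<le> (\<Sum>t<T. ?c t) + (\<Sum>t\<in>{T..<T+N}. ?c t)"
      using finite_horizon_lower_bound by simp
    also have "\<dots> = (\<Sum>t<T+N. ?c t)"
      using sum.atLeastLessThan_concat[of 0 T "T+N" ?c] by (simp add: atLeast0LessThan)
    finally show ?thesis
      by (intro order_trans[OF _ partial_cost_le[of x0 u "T+N"]]) simp
  qed
  then show "\<exists>M. \<forall>N\<ge>M. ereal ((\<Sum>t<T. ?c t) + qform (Xseq N) (traj x0 u T))
      \<le> cost A B Q R S x0 u" by blast
qed

lemma value_le_cost: "ereal (qform Xbar x0) \<le> cost A B Q R S x0 u"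
  using cost_lower_bound[where T = 0] by simp

text \<open>Since \<open>Xbar\<close> is a fixed point, the completed squares telescope along any
  trajectory.\<close>

lemma partial_cost_eq:
  "(\<Sum>t<T. stage (traj x0 u t) (u t)) + qform Xbar (traj x0 u T)
    = qform Xbar x0 + (\<Sum>t<T. qform (RX Xbar) (u t + KX Xbar *v traj x0 u t))"
proof (induction T)
  case 0
  then show ?case by simp
next
  case (Suc T)
  have "stage (traj x0 u T) (u T) + qform Xbar (traj x0 u (Suc T))
      = qform Xbar (traj x0 u T) + qform (RX Xbar) (u T + KX Xbar *v traj x0 u T)"
    using bellman_square[OF psd_Xbar, of "traj x0 u T" "u T"]
    by (simp add: Xbar_fixpoint bellman_def)
  with Suc show ?case by simp
qed

text \<open>Inputs added through \<open>G_of\<close> are invisible to the completed square.\<close>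

lemma RX_G: "RX Xbar *v (G_of B R Xbar *v v) = 0"
  using is_pinv_pinv[OF symmetric_RX[OF symmetric_Xbar]]
  by (simp add: is_pinv_def G_of_def matrix_vector_mult_diff_rdistrib
      matrix_vector_mult_diff_distrib matrix_vector_mul_assoc matrix_mul_assoc)

text \<open>All squares vanish, and the terminal term is dropped by its sign, so no decay of the
  state is required.\<close>

lemma feedback_cost_le:
  assumes "\<And>t. u t = - (KX Xbar *v traj x0 u t) + G_of B R Xbar *v v t"
  shows "cost A B Q R S x0 u \<le> ereal (qform Xbar x0)"
proof (rule cost_le)
  fix T
  have "u t + KX Xbar *v traj x0 u t = G_of B R Xbar *v v t" for t
    by (subst assms) simp
  then have "qform (RX Xbar) (u t + KX Xbar *v traj x0 u t) = 0" for t
    by (simp add: qform_def RX_G)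
  moreover have "0 \<le> qform Xbar (traj x0 u T)" using psd_Xbar by (simp add: pos_semidef_qform)
  ultimately show "(\<Sum>t<T. stage (traj x0 u t) (u t)) \<le> qform Xbar x0"
    using partial_cost_eq[where T = T and ?x0.0 = x0 and u = u] by simp
qed

lemma value_attained: "\<exists>u. cost A B Q R S x0 u = ereal (qform Xbar x0)"
proof -
  \<comment> \<open>Input and state determine each other under feedback; iterating the closed-loop
    map first breaks the circle.\<close>
  define x where "x t = ((\<lambda>x. A *v x - B *v (KX Xbar *v x)) ^^ t) x0" for t
  define u where "u t = - (KX Xbar *v x t)" for t
  have neg: "B *v (- y) = - (B *v y)" for y
    using matrix_vector_mult_diff_distrib[of B 0 y] by simp
  have "traj x0 u t = x t" for t
    by (induction t) (simp_all add: x_def u_def neg)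
  then have "u t = - (KX Xbar *v traj x0 u t) + G_of B R Xbar *v 0" for t
    by (simp add: u_def)
  then have "cost A B Q R S x0 u \<le> ereal (qform Xbar x0)"
    by (rule feedback_cost_le)
  then show ?thesis using value_le_cost antisym by blast
qed

text \<open>The lower bound retaining the terminal term leaves no room for a positive square. So
  each deviation from the feedback lies in the kernel of \<open>RX Xbar\<close>, where
  \<open>G_of\<close> acts as the identity, and the deviation itself serves as the free
  parameter.\<close>

lemma feedback_of_cost_le:
  assumes "cost A B Q R S x0 u \<le> ereal (qform Xbar x0)"
  shows "u t = - (KX Xbar *v traj x0 u t) + G_of B R Xbar *v (u t + KX Xbar *v traj x0 u t)"
proof -
  let ?w = "\<lambda>t. u t + KX Xbar *v traj x0 u t"
  have nonneg: "0 \<le> qform (RX Xbar) z" for z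
    using psd_RX[OF psd_Xbar] by (simp add: pos_semidef_qform)
  have "ereal (qform Xbar x0 + (\<Sum>i<Suc t. qform (RX Xbar) (?w i))) \<le> ereal (qform Xbar x0)"
    using order_trans[OF cost_lower_bound assms, of "Suc t"] unfolding partial_cost_eq .
  then have "(\<Sum>i<Suc t. qform (RX Xbar) (?w i)) \<le> 0" by simp
  moreover have "0 \<le> (\<Sum>i<t. qform (RX Xbar) (?w i))" by (intro sum_nonneg nonneg)
  ultimately have "qform (RX Xbar) (?w t) = 0" using nonneg[of "?w t"] by simp
  then have "RX Xbar *v ?w t = 0" by (rule psd_qform_zero_imp_kernel[OF psd_RX[OF psd_Xbar]])
  then have "G_of B R Xbar *v ?w t = ?w t"
    by (simp add: G_of_def matrix_vector_mult_diff_rdistrib matrix_vector_mul_assoc[symmetric])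
  then show ?thesis by simp
qed

lemma optimal_iff_cost_le:
  "optimal_control A B Q R S x0 u \<longleftrightarrow> cost A B Q R S x0 u \<le> ereal (qform Xbar x0)"
proof
  obtain w where "cost A B Q R S x0 w = ereal (qform Xbar x0)" using value_attained by blast
  then show "cost A B Q R S x0 u \<le> ereal (qform Xbar x0)" if "optimal_control A B Q R S x0 u"
    using that unfolding optimal_control_def by metis
  show "optimal_control A B Q R S x0 u" if "cost A B Q R S x0 u \<le> ereal (qform Xbar x0)"
    unfolding optimal_control_def using order_trans[OF that value_le_cost] by blast
qed

lemma optimal_iff_feedback:
  "optimal_control A B Q R S x0 u \<longleftrightarrow>
    (\<exists>v. \<forall>t. u t = - (KX Xbar *v traj x0 u t) + G_of B R Xbar *v v t)"
  unfolding optimal_iff_cost_le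
proof
  show "\<exists>v. \<forall>t. u t = - (KX Xbar *v traj x0 u t) + G_of B R Xbar *v v t"
    if "cost A B Q R S x0 u \<le> ereal (qform Xbar x0)"
    by (rule exI[where x = "\<lambda>t. u t + KX Xbar *v traj x0 u t"])
       (intro allI feedback_of_cost_le[OF that])
  show "cost A B Q R S x0 u \<le> ereal (qform Xbar x0)"
    if "\<exists>v. \<forall>t. u t = - (KX Xbar *v traj x0 u t) + G_of B R Xbar *v v t"
  proof -
    from that obtain v where "\<forall>t. u t = - (KX Xbar *v traj x0 u t) + G_of B R Xbar *v v t" ..
    then show ?thesis using feedback_cost_le by blast
  qed
qed

end

theorem theorem2p1:
  fixes A :: "real^'n^'n" and B :: "real^'m^'n"
    and Q :: "real^'n^'n" and R :: "real^'m^'m" and S :: "real^'m^'n"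
  assumes "symmetric Q" and "symmetric R"
    and "pos_semidef (Popov Q R S)"
    and "\<forall>x0. \<exists>u. cost A B Q R S x0 u < \<infinity>"
  shows "\<exists>Xbar.
      riccati_seq A B Q R S \<longlonglongrightarrow> Xbar \<and>
      pos_semidef Xbar \<and>
      CGDARE_solution A B Q R S Xbar \<and>
      (\<forall>x0. (\<exists>u. cost A B Q R S x0 u = ereal (x0 \<bullet> (Xbar *v x0))) \<and>
            (\<forall>u. ereal (x0 \<bullet> (Xbar *v x0)) \<le> cost A B Q R S x0 u)) \<and>
      (\<forall>X. pos_semidef X \<and> CGDARE_solution A B Q R S X \<longrightarrow> Xbar \<preceq> X) \<and>
      (\<forall>x0 u. optimal_control A B Q R S x0 u \<longleftrightarrow>
         (\<exists>v. \<forall>t. u t = - (K_of A B R S Xbar *v trajectory A B x0 u t) + G_of B R Xbar *v v t))"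
proof -
  interpret lq_finite A B Q R S
    using assms by unfold_locales auto
  show ?thesis
  proof (intro exI[of _ Xbar] conjI allI impI)
    show "\<exists>u. cost A B Q R S x0 u = ereal (x0 \<bullet> (Xbar *v x0))" for x0
      using value_attained unfolding qform_def .
    show "ereal (x0 \<bullet> (Xbar *v x0)) \<le> cost A B Q R S x0 u" for x0 u
      using value_le_cost unfolding qform_def .
  qed (use Xseq_tendsto psd_Xbar CGDARE_Xbar Xbar_minimal optimal_iff_feedback in blast)+
qed

end
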